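(* Let $X=\{x_1,\dots,x_n\}$ be positive integers with $\sum_{i=1}^n x_i=2B$, and let $I$ be the instance of $(1 \mid p\mathrm{MA} \mid \sum_j C_j)$ constructed from $X$ as described in the context. If there is a feasible schedule for $I$ with total completion time at most $Q=Q_0+B$, then there is a subset $X_1\subset X$ with $\sum_{x\in X_1}x=B$.
   Context: Problem $(1 \mid p\mathrm{MA} \mid \sum_j C_j)$: a single machine with maintenance level initially $\mathrm{ML}_0$ and maximum $\mathrm{ML}^{\max}$; each job $J_i$ has non-preemptive processing time $p_i$ and deterioration $\delta_i$, and processing it decreases the level by $\delta_i$; the level must never be negative; maintenance activities (MAs) of any duration $D\in[0,\mathrm{ML}^{\max}-\mathrm{ML}]$ ($\mathrm{ML}$ the current level) may be inserted, occupying the machine for time $D$ and raising the level by $D$. The objective is the total completion time $\sum_i C_i$. Construction of $I$ from $X$: there are $2n+3$ jobs $J_0,\dots,J_{2n+2}$. Fix an integer $M>(4n+8)B$. For $i=0,1,\dots,n$: $p_i=p_{n+1+i}=\sum_{j=1}^i x_j$ (so $p_0=0$) and $\delta_i=\delta_{n+1+i}=M-2p_i$. Also $p_{2n+2}=M-2B$, $\delta_{2n+2}=0$. The initial maintenance level is $\mathrm{ML}_0=\sum_{i=0}^n\delta_i-2B$ and the maximum maintenance level is $\mathrm{ML}^{\max}=\sum_{i=0}^n\delta_i$. Define $$Q_0=\sum_{j=0}^n(n-j+1)p_j+(n+2)\Big(\sum_{j=0}^np_j+2B+p_{2n+2}\Big)+\sum_{j=0}^n(j+1)(p_{n+1+j}+\delta_{n+1+j}),$$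 and $Q=Q_0+B$. *)

theory Defs
  imports Complex_Main
begin

record pma_instance =
  num_jobs :: nat
  proc :: "nat \<Rightarrow> real"
  deter :: "nat \<Rightarrow> real"
  init_level :: real
  max_level :: real

datatype activity = Job nat | MA real

text \<open>
  A schedule lists the activities in the order in which the machine executes them, each with its
  start time; idle time between activities is allowed. The explicit order is needed because
  activities of duration 0 may share a start time with others.
\<close>

type_synonym schedule = "(real \<times> activity) list"

fun duration :: "pma_instance \<Rightarrow> activity \<Rightarrow> real" where
  "duration I (Job i) = proc I i"
| "duration I (MA D) = D"

fun next_level :: "pma_instance \<Rightarrow> real \<Rightarrow> activity \<Rightarrow> real" where
  "next_level I L (Job i) = L - deter I i"
| "next_level I L (MA D) = L + D"

fun allowed :: "pma_instance \<Rightarrow> real \<Rightarrow> activity \<Rightarrow> bool" where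
  "allowed I L (Job i) \<longleftrightarrow> 0 \<le> L - deter I i"
| "allowed I L (MA D) \<longleftrightarrow> D \<in> {0..max_level I - L}"

text \<open>In \<open>executable_from I t L S\<close>, the machine is free from time \<open>t\<close> on and has level \<open>L\<close>.\<close>

fun executable_from :: "pma_instance \<Rightarrow> real \<Rightarrow> real \<Rightarrow> schedule \<Rightarrow> bool" where
  "executable_from I t L [] \<longleftrightarrow> True"
| "executable_from I t L ((s, a) # S) \<longleftrightarrow>
     t \<le> s \<and> allowed I L a \<and> executable_from I (s + duration I a) (next_level I L a) S"

fun job_sequence :: "schedule \<Rightarrow> nat list" where
  "job_sequence [] = []"
| "job_sequence ((s, Job i) # S) = i # job_sequence S"
| "job_sequence ((s, MA D) # S) = job_sequence S"

definition feasible :: "pma_instance \<Rightarrow> schedule \<Rightarrow> bool" where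
  "feasible I S \<longleftrightarrow>
     executable_from I 0 (init_level I) S \<and>
     distinct (job_sequence S) \<and> set (job_sequence S) = {..<num_jobs I}"

definition start_time :: "schedule \<Rightarrow> nat \<Rightarrow> real" where
  "start_time S i = (THE s. (s, Job i) \<in> set S)"

definition completion_time :: "pma_instance \<Rightarrow> schedule \<Rightarrow> nat \<Rightarrow> real" where
  "completion_time I S i = start_time S i + proc I i"

definition total_completion_time :: "pma_instance \<Rightarrow> schedule \<Rightarrow> real" where
  "total_completion_time I S = (\<Sum>i<num_jobs I. completion_time I S i)"

definition red_proc :: "nat \<Rightarrow> (nat \<Rightarrow> nat) \<Rightarrow> real \<Rightarrow> int \<Rightarrow> nat \<Rightarrow> real" where
  "red_proc n x B M i =
     (if i \<le> n then \<Sum>j=1..i. real (x j)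
      else if i \<le> 2 * n + 1 then \<Sum>j=1..i - (n + 1). real (x j)
      else real_of_int M - 2 * B)"

definition red_deter :: "nat \<Rightarrow> (nat \<Rightarrow> nat) \<Rightarrow> real \<Rightarrow> int \<Rightarrow> nat \<Rightarrow> real" where
  "red_deter n x B M i =
     (if i \<le> 2 * n + 1 then real_of_int M - 2 * red_proc n x B M i else 0)"

definition red_instance :: "nat \<Rightarrow> (nat \<Rightarrow> nat) \<Rightarrow> real \<Rightarrow> int \<Rightarrow> pma_instance" where
  "red_instance n x B M =
     \<lparr> num_jobs = 2 * n + 3,
       proc = red_proc n x B M,
       deter = red_deter n x B M,
       init_level = (\<Sum>i=0..n. red_deter n x B M i) - 2 * B,
       max_level = (\<Sum>i=0..n. red_deter n x B M i) \<rparr>"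

definition Q0 :: "nat \<Rightarrow> (nat \<Rightarrow> nat) \<Rightarrow> real \<Rightarrow> int \<Rightarrow> real" where
  "Q0 n x B M =
     (let p = red_proc n x B M; \<delta> = red_deter n x B M in
       (\<Sum>j=0..n. (real n - real j + 1) * p j)
       + (real n + 2) * ((\<Sum>j=0..n. p j) + 2 * B + p (2 * n + 2))
       + (\<Sum>j=0..n. (real j + 1) * (p (n + 1 + j) + \<delta> (n + 1 + j))))"

definition Q :: "nat \<Rightarrow> (nat \<Rightarrow> nat) \<Rightarrow> real \<Rightarrow> int \<Rightarrow> real" where
  "Q n x B M = Q0 n x B M + B"

end

theory Submission
  imports Defs
begin

text \<open>
  Only the order of the jobs matters: performing maintenance as late as possible, the \<open>k\<close>-th job
  cannot complete before the processing times of the first \<open>k\<close> jobs plus the positive part of their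
  total deterioration minus the initial level. Up to lower bounds that are attained at the optimum,
  this cost is a constant plus a weighted sum of processing times, in which the ordinary jobs
  carry the weights \<open>n, \<dots>, 1, 0, 0, 1, \<dots>, n\<close> in the order of execution, plus a penalty
  depending on the total processing time \<open>W + T\<close> of the first \<open>n + 1\<close> ordinary jobs, where \<open>W\<close> is
  the sum of one processing time from each pair.

  Writing each processing time as the sum of the \<open>x\<^sub>i\<close> below its index, the weighted sum splits into
  layers. If \<open>n + 1 - i + e\<^sub>i\<close> of the first \<open>n + 1\<close> ordinary jobs have index at least \<open>i\<close>, layer \<open>i\<close>
  contributes at least its minimum plus \<open>x\<^sub>i e\<^sub>i\<^sup>2\<close>, while \<open>T\<close> is the sum of the \<open>x\<^sub>i e\<^sub>i\<close>. As
  \<open>e\<^sub>i \<le> e\<^sub>i\<^sup>2\<close> for integers, the bound \<open>Q\<close> forces both sums to equal \<open>B\<close>, hence \<open>e\<^sub>i \<in> {0, 1}\<close>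
  for all \<open>i\<close>, and \<open>{i. e\<^sub>i = 1}\<close> is the desired subset.
\<close>

section \<open>Completion time bounds determined by the job order\<close>

definition late_bound :: "pma_instance \<Rightarrow> nat list \<Rightarrow> real" where
  "late_bound I js =
     (\<Sum>j\<leftarrow>js. proc I j) + max 0 ((\<Sum>j\<leftarrow>js. deter I j) - init_level I)"

lemma job_sequence_append: "job_sequence (S @ S') = job_sequence S @ job_sequence S'"
  by (induction S rule: job_sequence.induct) auto

lemma mem_job_sequence_iff: "i \<in> set (job_sequence S) \<longleftrightarrow> (\<exists>s. (s, Job i) \<in> set S)"
  by (induction S rule: job_sequence.induct) auto

text \<open>The positive part of the deficit is maintenance that cannot be avoided: an MA advances
  the clock by its nonnegative duration and reduces this part by at most as much. The level must
  also suffice for job \<open>i\<close> itself, so its deterioration is counted but its processing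
  time is not.\<close>

lemma start_time_ge:
  "executable_from I t L (S @ (s, Job i) # S') \<Longrightarrow>
   t + (\<Sum>j\<leftarrow>job_sequence S. proc I j)
     + max 0 ((\<Sum>j\<leftarrow>job_sequence S. deter I j) + deter I i - L) \<le> s"
proof (induction S arbitrary: t L rule: job_sequence.induct)
  case 1
  then show ?case by simp
next
  case (2 s' j S)
  from 2(2) have "t \<le> s'"
    and "executable_from I (s' + proc I j) (L - deter I j) (S @ (s, Job i) # S')"
    by auto
  with 2(1)[of "s' + proc I j" "L - deter I j"] show ?case
    by (simp add: algebra_simps max_def split: if_splits)
next
  case (3 s' D S)
  from 3(2) have "t \<le> s'" "0 \<le> D"
    and "executable_from I (s' + D) (L + D) (S @ (s, Job i) # S')"
    by auto
  with 3(1)[of "s' + D" "L + D"] show ?case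
    by (simp add: algebra_simps max_def split: if_splits)
qed

lemma start_time_split:
  assumes "distinct (job_sequence (S @ (s, Job i) # S'))"
  shows "start_time (S @ (s, Job i) # S') i = s"
proof -
  have "i \<notin> set (job_sequence S)" "i \<notin> set (job_sequence S')"
    using assms by (auto simp: job_sequence_append)
  then show ?thesis
    unfolding start_time_def by (intro the_equality) (auto simp: mem_job_sequence_iff)
qed

lemma completion_time_ge:
  assumes ex: "executable_from I 0 (init_level I) S" and dist: "distinct (job_sequence S)"
    and k: "k < length (job_sequence S)"
  shows "late_bound I (take (Suc k) (job_sequence S)) \<le> completion_time I S (job_sequence S ! k)"
proof -
  let ?js = "job_sequence S"
  have "?js ! k \<in> set ?js" using k by simp
  then obtain s where "(s, Job (?js ! k)) \<in> set S"
    by (auto simp: mem_job_sequence_iff)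
  then obtain S1 S2 where S: "S = S1 @ (s, Job (?js ! k)) # S2"
    by (meson split_list)
  have js: "?js = job_sequence S1 @ ?js ! k # job_sequence S2"
    by (subst S) (simp add: job_sequence_append)
  have len: "length (job_sequence S1) < length ?js"
    by (subst js) simp
  have "?js ! length (job_sequence S1) = ?js ! k"
    by (subst js) simp
  then have "length (job_sequence S1) = k"
    using dist k len by (simp add: nth_eq_iff_index_eq)
  then have "take (Suc k) ?js = job_sequence S1 @ [?js ! k]"
    using js by (metis append_eq_conv_conj take_Suc_conv_app_nth k)
  moreover have "start_time S (?js ! k) = s"
    using S dist start_time_split by metis
  moreover have "0 + (\<Sum>j\<leftarrow>job_sequence S1. proc I j)
     + max 0 ((\<Sum>j\<leftarrow>job_sequence S1. deter I j) + deter I (?js ! k) - init_level I) \<le> s"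
    using start_time_ge ex S by metis
  ultimately show ?thesis
    by (simp add: late_bound_def completion_time_def)
qed

lemma total_completion_time_ge:
  assumes "feasible I S"
  shows "(\<Sum>k<num_jobs I. late_bound I (take (Suc k) (job_sequence S)))
           \<le> total_completion_time I S"
proof -
  let ?js = "job_sequence S"
  have dist: "distinct ?js" and set: "set ?js = {..<num_jobs I}"
    and ex: "executable_from I 0 (init_level I) S"
    using assms by (auto simp: feasible_def)
  have len: "length ?js = num_jobs I"
    using distinct_card[OF dist] set by simp
  have "(\<Sum>k<num_jobs I. late_bound I (take (Suc k) ?js))
          \<le> (\<Sum>k<num_jobs I. completion_time I S (?js ! k))"
    by (intro sum_mono completion_time_ge ex dist) (simp add: len)
  also have "\<dots> = total_completion_time I S"
    unfolding total_completion_time_def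
    using bij_betw_nth[OF dist refl refl] set len
    by (intro sum.reindex_bij_betw) simp
  finally show ?thesis .
qed

text \<open>A job without deterioration only delays itself and its successors by its processing
  time; \<open>late_bound I us\<close> bounds its start. This separates the special job from the
  paired ones.\<close>

lemma sum_late_bound_insert:
  assumes "deter I i = 0"
  shows "(\<Sum>k<length (us @ i # vs). late_bound I (take (Suc k) (us @ i # vs)))
       = (\<Sum>k<length (us @ vs). late_bound I (take (Suc k) (us @ vs)))
         + late_bound I us + (real (length vs) + 1) * proc I i"
proof -
  let ?f = "\<lambda>k. late_bound I (take (Suc k) (us @ i # vs))"
  let ?g = "\<lambda>k. late_bound I (take (Suc k) (us @ vs))"
  let ?a = "length us"
  have split: "sum f {..<?a + m} = sum f {..<?a} + (\<Sum>k<m. f (?a + k))" for f :: "nat \<Rightarrow> real" and m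
    by (induction m) auto
  have "sum ?f {..<?a + Suc (length vs)}
      = sum ?f {..<?a} + (?f ?a + (\<Sum>k<length vs. ?f (?a + Suc k)))"
    unfolding split sum.lessThan_Suc_shift by simp
  also have "sum ?f {..<?a} = sum ?g {..<?a}"
    by (intro sum.cong) auto
  also have "?f ?a = late_bound I us + proc I i"
    using assms by (simp add: late_bound_def)
  also have "(\<Sum>k<length vs. ?f (?a + Suc k)) = (\<Sum>k<length vs. ?g (?a + k) + proc I i)"
    using assms by (intro sum.cong) (auto simp: late_bound_def Suc_diff_le)
  finally show ?thesis
    using split[of ?g "length vs"] by (simp add: sum.distrib algebra_simps)
qed

section \<open>Triangular sums, layers and prefix sums\<close>

text \<open>In increasing order, counted from 0, the k-th element of a set of naturals is at least
  k. In the induction, \<open>A\<close> fits below its new maximum \<open>b\<close>.\<close>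

lemma card_triangle_le_sum:
  fixes A :: "nat set"
  assumes "finite A"
  shows "real (card A) * (real (card A) - 1) \<le> 2 * (\<Sum>a\<in>A. real a)"
  using assms
proof (induction A rule: finite_linorder_max_induct)
  case empty
  then show ?case by simp
next
  case (insert b A)
  have "card A \<le> card {..<b}"
    using insert by (intro card_mono) auto
  moreover have "b \<notin> A"
    using insert by blast
  ultimately show ?case
    using insert by (simp add: algebra_simps)
qed

lemma card_triangle_le_sum_inj:
  fixes w :: "'a \<Rightarrow> nat"
  assumes "finite A" "inj_on w A"
  shows "real (card A) * (real (card A) - 1) \<le> 2 * (\<Sum>a\<in>A. real (w a))"
  using card_triangle_le_sum[of "w ` A"] assms by (simp add: card_image sum.reindex)

lemma sum_layers:
  fixes x :: "nat \<Rightarrow> real" and c :: "'a \<Rightarrow> real"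
  assumes "finite J" "\<And>j. j \<in> J \<Longrightarrow> \<sigma> j \<le> n"
  shows "(\<Sum>j\<in>J. c j * (\<Sum>i=1..\<sigma> j. x i)) = (\<Sum>i=1..n. x i * (\<Sum>j\<in>{j\<in>J. i \<le> \<sigma> j}. c j))"
proof -
  have "(\<Sum>j\<in>J. c j * (\<Sum>i=1..\<sigma> j. x i)) = (\<Sum>j\<in>J. \<Sum>i=1..n. if i \<le> \<sigma> j then c j * x i else 0)"
  proof (rule sum.cong[OF refl])
    fix j assume "j \<in> J"
    then have "{1..\<sigma> j} = {i\<in>{1..n}. i \<le> \<sigma> j}"
      using assms(2)[of j] by auto
    then show "c j * (\<Sum>i=1..\<sigma> j. x i) = (\<Sum>i=1..n. if i \<le> \<sigma> j then c j * x i else 0)"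
      by (simp only: sum.inter_filter[OF finite_atLeastAtMost] sum_distrib_left)
        (intro sum.cong; simp)
  qed
  also have "\<dots> = (\<Sum>i=1..n. \<Sum>j\<in>J. if i \<le> \<sigma> j then c j * x i else 0)"
    by (rule sum.swap)
  also have "\<dots> = (\<Sum>i=1..n. x i * (\<Sum>j\<in>{j\<in>J. i \<le> \<sigma> j}. c j))"
    by (simp only: sum.inter_filter[OF assms(1)] sum_distrib_left)
      (intro sum.cong; simp)
  finally show ?thesis .
qed

text \<open>The last term on the right has weight 0; including it makes the range that of the n + 1
  early jobs.\<close>

lemma sum_prefix_sums:
  fixes q :: "nat \<Rightarrow> real"
  shows "(\<Sum>k<m. \<Sum>j<Suc k. q j) = (\<Sum>j<Suc m. real (m - j) * q j)"
proof (induction m)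
  case (Suc m)
  have "(\<Sum>j<Suc m. real (Suc m - j) * q j) = (\<Sum>j<Suc m. real (m - j) * q j + q j)"
    by (intro sum.cong) (auto simp: Suc_diff_le algebra_simps)
  with Suc show ?case by (simp add: sum.distrib)
qed simp

lemma sum_suffix_sums:
  fixes q :: "nat \<Rightarrow> real"
  shows "m \<le> N \<Longrightarrow> (\<Sum>k=m..<N. \<Sum>j=Suc k..<N. q j) = (\<Sum>j=m..<N. real (j - m) * q j)"
proof (induction N rule: dec_induct)
  case (step N)
  have "(\<Sum>k=m..<N. \<Sum>j=Suc k..<Suc N. q j) = (\<Sum>k=m..<N. (\<Sum>j=Suc k..<N. q j) + q N)"
    by (intro sum.cong) auto
  with step show ?case by (simp add: sum.distrib)
qed simp


section \<open>Layer decomposition of a paired order\<close>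

lemma card_halves:
  "card {j. j < 2 * n + 2 \<and> P j}
     = card {j\<in>{..<Suc n}. P j} + card {j\<in>{Suc n..<2 * n + 2}. P j}"
proof -
  have eq: "{j. j < 2 * n + 2 \<and> P j} = {j\<in>{..<Suc n}. P j} \<union> {j\<in>{Suc n..<2 * n + 2}. P j}"
    by auto
  show ?thesis
    unfolding eq by (rule card_Un_disjoint) auto
qed

text \<open>
  Here \<open>\<sigma> k\<close> is the index in \<open>{0..n}\<close>, common to both jobs of a pair, of the \<open>k\<close>-th ordinary job
  (counting from 0); \<open>card_\<sigma>\<close> is all that is needed of the fact that every index occurs twice.
\<close>

locale paired_order =
  fixes n :: nat and x :: "nat \<Rightarrow> real" and \<sigma> :: "nat \<Rightarrow> nat"
  assumes x_nonneg: "0 \<le> x i"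
    and \<sigma>_le: "j < 2 * n + 2 \<Longrightarrow> \<sigma> j \<le> n"
    and card_\<sigma>: "i \<in> {1..n} \<Longrightarrow> card {j. j < 2 * n + 2 \<and> i \<le> \<sigma> j} = 2 * (n + 1 - i)"
begin

definition P :: "nat \<Rightarrow> real" where "P j = (\<Sum>i=1..j. x i)"

definition W :: real where "W = (\<Sum>j=0..n. P j)"

text \<open>\<open>2 * A\<close> is the weighted sum when each half contains one job of every pair,
  indices increasing in the first half and decreasing in the second.\<close>

definition A :: real where "A = (\<Sum>j=0..n. real (n - j) * P j)"

definition early :: "nat \<Rightarrow> nat" where "early i = card {j\<in>{..<Suc n}. i \<le> \<sigma> j}"

text \<open>The deviation from an even split of the \<open>2 * (n + 1 - i)\<close> jobs of index at
  least \<open>i\<close>; it may be negative.\<close>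

definition excess :: "nat \<Rightarrow> real" where "excess i = real (early i) - real (n + 1 - i)"

lemma W_layers: "W = (\<Sum>i=1..n. x i * real (n + 1 - i))"
proof -
  have "W = (\<Sum>j=0..n. 1 * (\<Sum>i=1..j. x i))"
    by (simp add: W_def P_def)
  also have "\<dots> = (\<Sum>i=1..n. x i * (\<Sum>j\<in>{j\<in>{0..n}. i \<le> j}. 1))"
    by (rule sum_layers) auto
  also have "\<dots> = (\<Sum>i=1..n. x i * real (n + 1 - i))"
  proof (intro sum.cong refl)
    fix i
    have "{j\<in>{0..n}. i \<le> j} = {i..n}" by auto
    then show "x i * (\<Sum>j\<in>{j\<in>{0..n}. i \<le> j}. 1) = x i * real (n + 1 - i)" by simp
  qed
  finally show ?thesis .
qed

lemma A_layers: "2 * A = (\<Sum>i=1..n. x i * (real (n + 1 - i) * (real (n + 1 - i) - 1)))"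
proof -
  have "A = (\<Sum>i=1..n. x i * (\<Sum>j\<in>{j\<in>{0..n}. i \<le> j}. real (n - j)))"
    unfolding A_def P_def by (rule sum_layers) auto
  also have "\<dots> = (\<Sum>i=1..n. x i * (real (n + 1 - i) * (real (n + 1 - i) - 1)) / 2)"
  proof (intro sum.cong refl)
    fix i assume i: "i \<in> {1..n}"
    have gauss: "(\<Sum>k<m. real k) = real m * (real m - 1) / 2" for m
      by (induction m) (auto simp: field_simps)
    have "(\<Sum>j\<in>{j\<in>{0..n}. i \<le> j}. real (n - j)) = (\<Sum>k<n + 1 - i. real k)"
      using i by (intro sum.reindex_bij_witness[of _ "\<lambda>k. n - k" "\<lambda>j. n - j"]) auto
    then show "x i * (\<Sum>j\<in>{j\<in>{0..n}. i \<le> j}. real (n - j))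
        = x i * (real (n + 1 - i) * (real (n + 1 - i) - 1)) / 2"
      by (simp only: gauss)
  qed
  finally show ?thesis by (simp add: sum_divide_distrib[symmetric])
qed

lemma sum_all: "(\<Sum>j<2 * n + 2. P (\<sigma> j)) = 2 * W"
proof -
  have "(\<Sum>j<2 * n + 2. 1 * P (\<sigma> j)) = (\<Sum>i=1..n. x i * (\<Sum>j\<in>{j\<in>{..<2 * n + 2}. i \<le> \<sigma> j}. 1))"
    unfolding P_def by (rule sum_layers) (auto intro: \<sigma>_le)
  also have "\<dots> = (\<Sum>i=1..n. 2 * (x i * real (n + 1 - i)))"
    by (intro sum.cong refl) (use card_\<sigma> in simp)
  finally show ?thesis by (simp add: W_layers sum_distrib_left)
qed

lemma sum_early: "(\<Sum>j<Suc n. P (\<sigma> j)) = W + (\<Sum>i=1..n. x i * excess i)"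
proof -
  have "(\<Sum>j<Suc n. 1 * P (\<sigma> j)) = (\<Sum>i=1..n. x i * (\<Sum>j\<in>{j\<in>{..<Suc n}. i \<le> \<sigma> j}. 1))"
    unfolding P_def by (rule sum_layers) (auto intro: \<sigma>_le)
  also have "\<dots> = (\<Sum>i=1..n. x i * real (n + 1 - i) + x i * excess i)"
    by (intro sum.cong refl) (simp add: excess_def early_def algebra_simps)
  finally show ?thesis by (simp add: W_layers sum.distrib)
qed

text \<open>With m = n + 1 - i and e the excess, layer \<open>i\<close> has m + e early and m - e
  late jobs, with distinct weights in each half. The two triangular bounds add up to m(m - 1) +
  e^2.\<close>

lemma weighted_sum_ge:
  "2 * A + (\<Sum>i=1..n. x i * (excess i)\<^sup>2)
     \<le> (\<Sum>j<Suc n. real (n - j) * P (\<sigma> j)) + (\<Sum>j=Suc n..<2 * n + 2. real (j - Suc n) * P (\<sigma> j))"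
proof -
  have "2 * A + (\<Sum>i=1..n. x i * (excess i)\<^sup>2)
      = (\<Sum>i=1..n. x i * (real (n + 1 - i) * (real (n + 1 - i) - 1) + (excess i)\<^sup>2))"
    by (simp add: A_layers sum.distrib[symmetric] distrib_left)
  also have "\<dots> \<le> (\<Sum>i=1..n. x i * ((\<Sum>j\<in>{j\<in>{..<Suc n}. i \<le> \<sigma> j}. real (n - j))
      + (\<Sum>j\<in>{j\<in>{Suc n..<2 * n + 2}. i \<le> \<sigma> j}. real (j - Suc n))))"
  proof (intro sum_mono mult_left_mono x_nonneg)
    fix i assume i: "i \<in> {1..n}"
    let ?E = "{j\<in>{..<Suc n}. i \<le> \<sigma> j}" and ?L = "{j\<in>{Suc n..<2 * n + 2}. i \<le> \<sigma> j}"
    define m where "m = real (n + 1 - i)"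
    have E: "real (card ?E) = m + excess i"
      by (simp add: excess_def early_def m_def)
    have "card ?E + card ?L = 2 * (n + 1 - i)"
      using card_\<sigma>[OF i] card_halves[of n "\<lambda>j. i \<le> \<sigma> j"] by simp
    then have "real (card ?E) + real (card ?L) = 2 * m"
      unfolding m_def by linarith
    with E have L: "real (card ?L) = m - excess i" by simp
    have "real (card ?E) * (real (card ?E) - 1) \<le> 2 * (\<Sum>j\<in>?E. real (n - j))"
      by (rule card_triangle_le_sum_inj) (auto simp: inj_on_def)
    moreover have "real (card ?L) * (real (card ?L) - 1) \<le> 2 * (\<Sum>j\<in>?L. real (j - Suc n))"
      by (rule card_triangle_le_sum_inj) (auto simp: inj_on_def)
    ultimately show "real (n + 1 - i) * (real (n + 1 - i) - 1) + (excess i)\<^sup>2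
        \<le> (\<Sum>j\<in>?E. real (n - j)) + (\<Sum>j\<in>?L. real (j - Suc n))"
      unfolding E L m_def[symmetric] by (simp add: algebra_simps power2_eq_square)
  qed
  also have "\<dots> = (\<Sum>i=1..n. x i * (\<Sum>j\<in>{j\<in>{..<Suc n}. i \<le> \<sigma> j}. real (n - j)))
      + (\<Sum>i=1..n. x i * (\<Sum>j\<in>{j\<in>{Suc n..<2 * n + 2}. i \<le> \<sigma> j}. real (j - Suc n)))"
    by (simp only: distrib_left sum.distrib)
  also have "(\<Sum>i=1..n. x i * (\<Sum>j\<in>{j\<in>{..<Suc n}. i \<le> \<sigma> j}. real (n - j)))
      = (\<Sum>j<Suc n. real (n - j) * P (\<sigma> j))"
    unfolding P_def by (rule sum_layers[symmetric]) (auto intro: \<sigma>_le)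
  also have "(\<Sum>i=1..n. x i * (\<Sum>j\<in>{j\<in>{Suc n..<2 * n + 2}. i \<le> \<sigma> j}. real (j - Suc n)))
      = (\<Sum>j=Suc n..<2 * n + 2. real (j - Suc n) * P (\<sigma> j))"
    unfolding P_def by (rule sum_layers[symmetric]) (auto intro: \<sigma>_le)
  finally show ?thesis .
qed

lemma excess_le_square: "excess i \<le> (excess i)\<^sup>2"
proof -
  define z where "z = int (early i) - int (n + 1 - i)"
  have "excess i = of_int z"
    by (simp add: excess_def z_def)
  moreover have "z \<le> z\<^sup>2"
  proof (cases "z \<le> 0")
    case True
    then show ?thesis by (rule order_trans) simp
  next
    case False
    then show ?thesis by (intro self_le_power) auto
  qed
  then have "real_of_int z \<le> real_of_int (z\<^sup>2)"
    by (simp only: of_int_le_iff)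
  ultimately show ?thesis by simp
qed

text \<open>Subtracting the equations leaves a zero sum of nonnegative terms, so every layer with
  \<open>x i\<close> nonzero has excess 0 or 1.\<close>

lemma subset_of_tight:
  assumes "(\<Sum>i=1..n. x i * (excess i)\<^sup>2) = B" "(\<Sum>i=1..n. x i * excess i) = B"
  shows "\<exists>K\<subseteq>{1..n}. (\<Sum>i\<in>K. x i) = B"
proof -
  let ?K = "{i\<in>{1..n}. excess i = 1}"
  have "(\<Sum>i=1..n. x i * ((excess i)\<^sup>2 - excess i)) = 0"
    by (simp only: right_diff_distrib sum_subtractf assms diff_self)
  then have zero: "\<forall>i\<in>{1..n}. x i * ((excess i)\<^sup>2 - excess i) = 0"
    by (rule sum_nonneg_eq_0_iff[OF finite_atLeastAtMost, THEN iffD1, rotated])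
      (intro mult_nonneg_nonneg x_nonneg, simp only: diff_ge_0_iff_ge excess_le_square)
  have "(\<Sum>i=1..n. x i * excess i) = (\<Sum>i=1..n. if excess i = 1 then x i else 0)"
  proof (rule sum.cong[OF refl])
    fix i assume "i \<in> {1..n}"
    then have "x i * (excess i * (excess i - 1)) = 0"
      using bspec[OF zero] by (simp only: power2_eq_square right_diff_distrib mult_1_right)
    then show "x i * excess i = (if excess i = 1 then x i else 0)"
      by auto
  qed
  also have "\<dots> = (\<Sum>i\<in>?K. x i)"
    by (rule sum.inter_filter[OF finite_atLeastAtMost, symmetric])
  finally have "(\<Sum>i\<in>?K. x i) = B"
    by (simp only: assms(2))
  moreover have "?K \<subseteq> {1..n}" by auto
  ultimately show ?thesis by (intro exI[of _ ?K] conjI)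
qed

section \<open>Cost bound and position of the special job\<close>

text \<open>\<open>F1\<close> serves the first n jobs and \<open>F2\<close> the last n + 1, where
  \<open>sum_all\<close> turns 2W minus a prefix sum into a suffix sum. \<open>F (Suc n)\<close> is
  kept, since there both bounds are needed later.\<close>

lemma sum_cost_ge:
  assumes F1: "\<And>k. k \<le> 2 * n + 2 \<Longrightarrow> (\<Sum>j<k. P (\<sigma> j)) \<le> F k"
    and F2: "\<And>k. k \<le> 2 * n + 2 \<Longrightarrow> (real k - real n - 1) * M + 2 * W + 2 * B - (\<Sum>j<k. P (\<sigma> j)) \<le> F k"
  shows "2 * A + (\<Sum>i=1..n. x i * (excess i)\<^sup>2) + F (Suc n)
     + (real n + 1) * (real n + 2) / 2 * M + 2 * (real n + 1) * B
     \<le> (\<Sum>k<2 * n + 2. F (Suc k))"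
proof -
  have "(\<Sum>j<Suc n. real (n - j) * P (\<sigma> j)) \<le> (\<Sum>k<n. F (Suc k))"
    unfolding sum_prefix_sums[symmetric] by (intro sum_mono F1) auto
  moreover have "(\<Sum>j=Suc n..<2 * n + 2. real (j - Suc n) * P (\<sigma> j))
      + (\<Sum>k=Suc n..<2 * n + 2. (real k - real n) * M + 2 * B) \<le> (\<Sum>k=Suc n..<2 * n + 2. F (Suc k))"
  proof -
    have "(\<Sum>j=Suc k..<2 * n + 2. P (\<sigma> j)) + ((real k - real n) * M + 2 * B) \<le> F (Suc k)"
      if "k \<in> {Suc n..<2 * n + 2}" for k
    proof -
      have "(\<Sum>j<Suc k. P (\<sigma> j)) + (\<Sum>j=Suc k..<2 * n + 2. P (\<sigma> j)) = 2 * W"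
        unfolding sum_all[symmetric] lessThan_atLeast0
        by (rule sum.atLeastLessThan_concat) (use that in auto)
      moreover have "real (Suc k) - real n - 1 = real k - real n" by simp
      then have "(real k - real n) * M + 2 * W + 2 * B - (\<Sum>j<Suc k. P (\<sigma> j)) \<le> F (Suc k)"
        using F2[of "Suc k"] that by (metis Suc_leI atLeastLessThan_iff)
      ultimately show ?thesis by linarith
    qed
    then have "(\<Sum>k=Suc n..<2 * n + 2. (\<Sum>j=Suc k..<2 * n + 2. P (\<sigma> j))
        + ((real k - real n) * M + 2 * B)) \<le> (\<Sum>k=Suc n..<2 * n + 2. F (Suc k))"
      by (rule sum_mono)
    then show ?thesis
      using sum_suffix_sums[of "Suc n" "2 * n + 2" "\<lambda>j. P (\<sigma> j)"]
      unfolding sum.distrib by linarith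
  qed
  moreover have "(\<Sum>k=Suc n..<2 * n + 2. (real k - real n) * M + 2 * B)
      = (real n + 1) * (real n + 2) / 2 * M + 2 * (real n + 1) * B"
  proof -
    have closed: "(\<Sum>k=Suc n..<Suc n + m. (real k - real n) * M + 2 * B)
        = real m * (real m + 1) / 2 * M + 2 * real m * B" for m
      by (induction m) (auto simp: field_simps)
    have eq: "2 * n + 2 = Suc n + Suc n" by simp
    show ?thesis
      unfolding eq closed by (simp add: add.commute)
  qed
  moreover have "(\<Sum>k<2 * n + 2. F (Suc k))
      = (\<Sum>k<n. F (Suc k)) + F (Suc n) + (\<Sum>k=Suc n..<2 * n + 2. F (Suc k))"
  proof -
    have "(\<Sum>k<Suc n. F (Suc k)) + (\<Sum>k=Suc n..<2 * n + 2. F (Suc k)) = (\<Sum>k<2 * n + 2. F (Suc k))"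
      unfolding lessThan_atLeast0 by (rule sum.atLeastLessThan_concat) auto
    then show ?thesis by simp
  qed
  ultimately show ?thesis
    using weighted_sum_ge by linarith
qed

lemma P_nonneg: "0 \<le> P j"
  unfolding P_def by (intro sum_nonneg x_nonneg)

lemma P_mono: "i \<le> j \<Longrightarrow> P i \<le> P j"
  unfolding P_def by (intro sum_mono2) (auto intro: x_nonneg)

text \<open>
  \<open>F k\<close> bounds the completion time of the \<open>k\<close>-th ordinary job when the special job \<open>2n + 2\<close> is left
  out, and \<open>a\<close> is the number of ordinary jobs preceding the special one.
\<close>

lemma cheap_order_imp_subset:
  assumes F1: "\<And>k. k \<le> 2 * n + 2 \<Longrightarrow> (\<Sum>j<k. P (\<sigma> j)) \<le> F k"
    and F2: "\<And>k. k \<le> 2 * n + 2 \<Longrightarrow> (real k - real n - 1) * M + 2 * W + 2 * B - (\<Sum>j<k. P (\<sigma> j)) \<le> F k"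
    and B: "P n = 2 * B" and M: "(4 * real n + 8) * B < M" and a: "a \<le> 2 * n + 2"
    and cheap: "(\<Sum>k<2 * n + 2. F (Suc k)) + F a + (2 * real n + 3 - real a) * (M - 2 * B)
      \<le> 2 * A + 2 * W + ((real n + 2) + (real n + 1) * (real n + 2) / 2) * M + B"
  shows "\<exists>K\<subseteq>{1..n}. (\<Sum>i\<in>K. x i) = B"
proof -
  define T where "T = (\<Sum>i=1..n. x i * excess i)"
  define R where "R = (\<Sum>i=1..n. x i * (excess i)\<^sup>2)"
  have TR: "T \<le> R"
    unfolding T_def R_def by (intro sum_mono mult_left_mono excess_le_square x_nonneg)
  have Sn: "(\<Sum>j<Suc n. P (\<sigma> j)) = W + T"
    by (simp only: sum_early T_def)
  have F1n: "W + T \<le> F (Suc n)"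
    using F1[of "Suc n"] Sn by simp
  have F2n: "W + 2 * B - T \<le> F (Suc n)"
    using F2[of "Suc n"] Sn by simp
  have B0: "0 \<le> B"
    using P_nonneg[of n] B by simp
  then have nB: "0 \<le> real n * B" by simp
  have *: "R + F (Suc n) + F a + (2 * real n + 3 - real a) * (M - 2 * B)
      \<le> 2 * W + (real n + 2) * M - 2 * (real n + 1) * B + B"
    using sum_cost_ge[of F M B, OF F1 F2] cheap unfolding R_def[symmetric]
    by (simp add: algebra_simps)
  \<comment> \<open>Delaying the special job costs nothing at the optimum, but starting it earlier costs about \<open>M\<close>.\<close>
  consider "a \<le> n" | "a = Suc n" | "Suc n < a" by linarith
  then have "T = B \<and> R = B"
  proof cases
    case 1
    \<comment> \<open>This case is contradictory: the special job has weight at least n + 3 against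
      n + 2 in the budget, which forces M <= W + 3B.\<close>
    have "W \<le> (\<Sum>j=0..n. 2 * B)"
      unfolding W_def B[symmetric] by (intro sum_mono P_mono) auto
    then have W: "W \<le> 2 * (real n + 1) * B" by (simp add: algebra_simps)
    have "2 * B \<le> M"
      using M B0 nB unfolding distrib_right by linarith
    then have "(real n + 3) * (M - 2 * B) \<le> (2 * real n + 3 - real a) * (M - 2 * B)"
      using 1 by (intro mult_right_mono) auto
    moreover have "0 \<le> F a"
      using F1[OF a] sum_nonneg[of "{..<a}" "\<lambda>j. P (\<sigma> j)"] P_nonneg by fastforce
    ultimately have "M \<le> W + 3 * B"
      using * TR F2n by (simp add: algebra_simps)
    moreover have "W + 3 * B \<le> (4 * real n + 8) * B"
      using W B0 nB unfolding distrib_right distrib_left by linarith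
    ultimately show ?thesis using M by simp
  next
    case 2
    then have "R + 2 * F (Suc n) \<le> 2 * W + 3 * B"
      using * by (simp add: algebra_simps)
    \<comment> \<open>Adding both bounds on \<open>F (Suc n)\<close> gives R <= B; doubling the
      second gives R + B <= 2T. With T <= R all three are equal.\<close>
    then show ?thesis using TR F1n F2n by auto
  next
    case 3
    \<comment> \<open>Each further ordinary job placed before the special one saves M - 2B in the
      weight term, but raises the \<open>F2\<close> bound on \<open>F a\<close> by at least M - 2B
      because no \<open>P\<close> value exceeds 2B.\<close>
    have "(\<Sum>j<a. P (\<sigma> j)) = (\<Sum>j<Suc n. P (\<sigma> j)) + (\<Sum>j=Suc n..<a. P (\<sigma> j))"
      unfolding lessThan_atLeast0 by (rule sum.atLeastLessThan_concat[symmetric]) (use 3 in auto)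
    also have "(\<Sum>j=Suc n..<a. P (\<sigma> j)) \<le> (\<Sum>j=Suc n..<a. 2 * B)"
      unfolding B[symmetric] using a by (intro sum_mono P_mono \<sigma>_le) auto
    finally have "(\<Sum>j<a. P (\<sigma> j)) \<le> W + T + (real a - real n - 1) * (2 * B)"
      using 3 unfolding Sn by (simp add: of_nat_diff algebra_simps)
    with F2[OF a] have
      "(real a - real n - 1) * M + W + 2 * B - T - (real a - real n - 1) * (2 * B) \<le> F a"
      by linarith
    then have "R + F (Suc n) - T \<le> W + B"
      using * by (simp add: algebra_simps)
    then show ?thesis using TR F1n F2n by auto
  qed
  then show ?thesis
    using subset_of_tight[of B] by (auto simp: T_def R_def)
qed

end


section \<open>Application to the constructed instance\<close>

lemma card_paired_index_ge:
  assumes "i \<in> {1..n}"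
  shows "card {j. j < 2 * n + 2 \<and> i \<le> (if j \<le> n then j else j - (n + 1))} = 2 * (n + 1 - i)"
proof -
  have "{j. j < 2 * n + 2 \<and> i \<le> (if j \<le> n then j else j - (n + 1))}
      = {i..<n + 1} \<union> {n + 1 + i..<2 * n + 2}"
    using assms by (auto split: if_splits)
  moreover have "card ({i..<n + 1} \<union> {n + 1 + i..<2 * n + 2}) = (n + 1 - i) + (n + 1 - i)"
    by (subst card_Un_disjoint) auto
  ultimately show ?thesis by simp
qed

theorem theorem10:
  fixes n :: nat and x :: "nat \<Rightarrow> nat" and B :: real and M :: int
  assumes "\<And>i. i \<in> {1..n} \<Longrightarrow> 0 < x i"
    and "(\<Sum>i=1..n. real (x i)) = 2 * B"
    and "(4 * real n + 8) * B < real_of_int M"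
    and "\<exists>S. feasible (red_instance n x B M) S \<and>
             total_completion_time (red_instance n x B M) S \<le> Q n x B M"
  shows "\<exists>K\<subseteq>{1..n}. (\<Sum>i\<in>K. real (x i)) = B"
proof -
  define I where "I = red_instance n x B M"
  obtain S where feas: "feasible I S" and cost: "total_completion_time I S \<le> Q n x B M"
    using assms(4) unfolding I_def by blast
  have num: "num_jobs I = 2 * n + 3" and proc: "proc I = red_proc n x B M"
    and deter: "deter I = red_deter n x B M"
    by (simp_all add: I_def red_instance_def)
  let ?js = "job_sequence S"
  have dist: "distinct ?js" and set: "set ?js = {..<2 * n + 3}"
    using feas num by (auto simp: feasible_def)
  then have "2 * n + 2 \<in> set ?js" by simp
  then obtain us vs where js: "?js = us @ (2 * n + 2) # vs"
    by (meson split_list)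
  define os where "os = us @ vs"
  have os_dist: "distinct os"
    using dist js by (auto simp: os_def)
  have "set ?js = insert (2 * n + 2) (set os)" "2 * n + 2 \<notin> set os"
    using dist js by (auto simp: os_def)
  then have "set os = {..<2 * n + 3} - {2 * n + 2}"
    using set by (metis Diff_insert_absorb)
  also have "\<dots> = {..<2 * n + 2}" by auto
  finally have os_set: "set os = {..<2 * n + 2}" .
  have os_len: "length os = 2 * n + 2"
    using distinct_card[OF os_dist] os_set by simp
  define r where "r = (\<lambda>j. if j \<le> n then j else j - (n + 1))"
  define \<sigma> where "\<sigma> = (\<lambda>k. r (os ! k))"
  have os_bij: "bij_betw ((!) os) {..<2 * n + 2} {..<2 * n + 2}"
    using bij_betw_nth[OF os_dist refl refl] os_set os_len by simp
  interpret paired_order n "\<lambda>i. real (x i)" \<sigma>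
  proof
    fix j assume "j < 2 * n + 2"
    then have "os ! j < 2 * n + 2"
      using bij_betw_apply[OF os_bij] by simp
    then show "\<sigma> j \<le> n" by (auto simp: \<sigma>_def r_def)
  next
    fix i assume i: "i \<in> {1..n}"
    have "bij_betw ((!) os) {j. j < 2 * n + 2 \<and> i \<le> \<sigma> j} {j. j < 2 * n + 2 \<and> i \<le> r j}"
      unfolding bij_betw_def
    proof
      show "inj_on ((!) os) {j. j < 2 * n + 2 \<and> i \<le> \<sigma> j}"
        by (rule inj_on_subset[OF bij_betw_imp_inj_on[OF os_bij]]) auto
      have "(!) os ` {j. j < 2 * n + 2 \<and> i \<le> \<sigma> j} = {j \<in> (!) os ` {..<2 * n + 2}. i \<le> r j}"
        unfolding \<sigma>_def by auto
      then show "(!) os ` {j. j < 2 * n + 2 \<and> i \<le> \<sigma> j} = {j. j < 2 * n + 2 \<and> i \<le> r j}"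
        by (simp only: bij_betw_imp_surj_on[OF os_bij] lessThan_iff)
    qed
    then show "card {j. j < 2 * n + 2 \<and> i \<le> \<sigma> j} = 2 * (n + 1 - i)"
      using card_paired_index_ge[OF i] by (simp only: bij_betw_same_card r_def)
  qed simp
  have procP: "red_proc n x B M j = P (r j)" and deterP: "red_deter n x B M j = M - 2 * P (r j)"
    if "j < 2 * n + 2" for j
    using that by (auto simp: red_proc_def red_deter_def P_def r_def)
  have init: "init_level I = (real n + 1) * M - 2 * W - 2 * B"
  proof -
    have "(\<Sum>i=0..n. red_deter n x B M i) = (\<Sum>i=0..n. M - 2 * P i)"
      by (intro sum.cong) (auto simp: deterP r_def)
    then show ?thesis
      by (simp add: I_def red_instance_def W_def sum_subtractf sum_distrib_left algebra_simps)
  qed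
  define F where "F k = late_bound I (take k os)" for k
  \<comment> \<open>The two branches of the maximum yield \<open>F1\<close> and \<open>F2\<close>;
    the coefficient 2 in the deterioration flips the sign of the prefix sum.\<close>
  have F: "F k = (\<Sum>j<k. P (\<sigma> j))
      + max 0 (real k * M - 2 * (\<Sum>j<k. P (\<sigma> j)) - ((real n + 1) * M - 2 * W - 2 * B))"
    if k: "k \<le> 2 * n + 2" for k
  proof -
    have nth: "os ! j < 2 * n + 2" if "j < k" for j
      using bij_betw_apply[OF os_bij, of j] that k by simp
    have take_sum: "(\<Sum>j\<leftarrow>take k os. f j) = (\<Sum>j<k. f (os ! j))" for f :: "nat \<Rightarrow> real"
      using k os_len by (simp add: sum_list_sum_nth lessThan_atLeast0)
    have "(\<Sum>j<k. red_proc n x B M (os ! j)) = (\<Sum>j<k. P (\<sigma> j))"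
      by (intro sum.cong) (simp_all add: \<sigma>_def procP[OF nth])
    moreover have "(\<Sum>j<k. red_deter n x B M (os ! j)) = (\<Sum>j<k. M - 2 * P (\<sigma> j))"
      by (intro sum.cong) (simp_all add: \<sigma>_def deterP[OF nth])
    ultimately show ?thesis
      unfolding F_def late_bound_def take_sum proc deter init
      by (simp add: sum_subtractf sum_distrib_left)
  qed
  have special: "deter I (2 * n + 2) = 0" "proc I (2 * n + 2) = M - 2 * B"
    by (simp_all add: proc deter red_deter_def red_proc_def)
  have vs_len: "real (length vs) + 1 = 2 * real n + 3 - real (length us)"
    and us_le: "length us \<le> 2 * n + 2"
    using os_len by (auto simp: os_def)
  have js_len: "length ?js = 2 * n + 3"
    using distinct_card[OF dist] set by simp
  have F_us: "late_bound I us = F (length us)"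
    by (simp add: F_def os_def)
  have "(\<Sum>k<2 * n + 3. late_bound I (take (Suc k) ?js))
      = (\<Sum>k<2 * n + 2. F (Suc k)) + F (length us)
        + (2 * real n + 3 - real (length us)) * (M - 2 * B)"
    using sum_late_bound_insert[OF special(1), of us vs]
    unfolding js[symmetric] os_def[symmetric] js_len os_len vs_len special(2) F_us
      F_def[symmetric] .
  then have "(\<Sum>k<2 * n + 2. F (Suc k)) + F (length us)
        + (2 * real n + 3 - real (length us)) * (M - 2 * B) \<le> Q n x B M"
    using total_completion_time_ge[OF feas] cost num by simp
  also have "Q n x B M
      = 2 * A + 2 * W + ((real n + 2) + (real n + 1) * (real n + 2) / 2) * M + B"
  proof -
    have "(\<Sum>j=0..n. (real n - real j + 1) * red_proc n x B M j)
        = (\<Sum>j=0..n. real (n - j) * P j + P j)"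
      by (intro sum.cong) (auto simp: procP r_def of_nat_diff algebra_simps)
    then have 1: "(\<Sum>j=0..n. (real n - real j + 1) * red_proc n x B M j) = A + W"
      by (simp add: A_def W_def sum.distrib)
    have 2: "(\<Sum>j=0..n. red_proc n x B M j) = W"
      unfolding W_def by (intro sum.cong) (auto simp: procP r_def)
    \<comment> \<open>Here p + delta = M - \<open>P j\<close>, and j + 1 is split as (n + 1) - (n -
      j) to produce \<open>A\<close>.\<close>
    have "(\<Sum>j=0..n. (real j + 1) * (red_proc n x B M (n + 1 + j) + red_deter n x B M (n + 1 + j)))
        = (\<Sum>j=0..n. (real j + 1) * M + (real (n - j) * P j - (real n + 1) * P j))"
      by (intro sum.cong) (auto simp: procP deterP r_def of_nat_diff algebra_simps)
    also have "\<dots> = (\<Sum>j=0..n. real j + 1) * M + (A - (real n + 1) * W)"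
      unfolding A_def W_def sum_distrib_left sum_distrib_right
      by (simp only: sum.distrib sum_subtractf)
    also have "(\<Sum>j=0..n. real j + 1) = (real n + 1) * (real n + 2) / 2"
      by (induction n) (auto simp: field_simps)
    finally have 3: "(\<Sum>j=0..n. (real j + 1)
          * (red_proc n x B M (n + 1 + j) + red_deter n x B M (n + 1 + j)))
        = (real n + 1) * (real n + 2) / 2 * M + (A - (real n + 1) * W)" .
    show ?thesis
      unfolding Q_def Q0_def Let_def 1 2 3 special(2)[unfolded proc] by (simp add: algebra_simps)
  qed
  finally show ?thesis
    using assms(2,3) us_le
    by (intro cheap_order_imp_subset[of F "real_of_int M" B "length us"])
      (auto simp: F P_def algebra_simps)
qed

end
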